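(* Consider Misère Connect Four ($k=4$) on a board of height $h=6$ and width $w=7$. If P2 plays the take-even strategy, then, whatever P1 does, P2 always has a move prescribed by the strategy available, and P1 is eventually forced to connect four (before P2 does). In particular, P2 has a guaranteed win.
   Context: Misère Connect $k$ is played on a grid with $w$ columns and $h$ rows. Player 1 (P1, pieces X) and Player 2 (P2, pieces O) alternate turns, P1 first. On each turn the player selects a non-full column and their piece occupies the lowest empty cell of that column; a column is full after $h$ plays. A player connects $k$ when $k$ of their pieces occupy $k$ consecutive cells in a horizontal, vertical, or diagonal (either direction) line. The first player to connect $k$ loses (the other wins) and the game ends. If the board fills with no player having connected $k$, the game is a draw. Rows are numbered $1,2,\dots,h$ from the bottom. The take-even strategy for P2 is: on every turn, play in an even-numbered row (equivalently, directly on top of P1's most recent piece). *)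

theory Defs
  imports Main
begin

datatype player = P1 | P2

fun opponent :: "player \<Rightarrow> player" where
  "opponent P1 = P2"
| "opponent P2 = P1"

text \<open>Cells are pairs (column, row), both numbered from 1; row 1 is the bottom row.\<close>

type_synonym board = "nat \<times> nat \<Rightarrow> player option"

definition landing_row :: "board \<Rightarrow> nat \<Rightarrow> nat" where
  "landing_row b c = (LEAST r. 1 \<le> r \<and> b (c, r) = None)"

definition drop_piece :: "board \<Rightarrow> player \<Rightarrow> nat \<Rightarrow> board" where
  "drop_piece b p c = b((c, landing_row b c) := Some p)"

definition column_full :: "nat \<Rightarrow> board \<Rightarrow> nat \<Rightarrow> bool" where
  "column_full h b c \<longleftrightarrow> (\<forall>r\<in>{1..h}. b (c, r) \<noteq> None)"

definition legal_moves :: "nat \<Rightarrow> nat \<Rightarrow> board \<Rightarrow> nat set" where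
  "legal_moves w h b = {c \<in> {1..w}. \<not> column_full h b c}"

definition board_full :: "nat \<Rightarrow> nat \<Rightarrow> board \<Rightarrow> bool" where
  "board_full w h b \<longleftrightarrow> (\<forall>c\<in>{1..w}. column_full h b c)"

text \<open>The disjuncts are horizontal, vertical, rising diagonal and falling diagonal lines.\<close>

definition connects :: "nat \<Rightarrow> board \<Rightarrow> player \<Rightarrow> bool" where
  "connects k b p \<longleftrightarrow> (\<exists>c r.
     (\<forall>i<k. b (c + i, r) = Some p) \<or>
     (\<forall>i<k. b (c, r + i) = Some p) \<or>
     (\<forall>i<k. b (c + i, r + i) = Some p) \<or>
     (\<forall>i<k. b (c + i, r + (k - 1 - i)) = Some p))"

text \<open>A play is the chronological list of the columns chosen by the two players.\<close>

definition position :: "nat list \<Rightarrow> board \<times> player" where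
  "position ms = foldl (\<lambda>(b, p) c. (drop_piece b p c, opponent p)) (\<lambda>_. None, P1) ms"

definition board_of :: "nat list \<Rightarrow> board" where
  "board_of ms = fst (position ms)"

definition to_move :: "nat list \<Rightarrow> player" where
  "to_move ms = snd (position ms)"

definition finished :: "nat \<Rightarrow> nat \<Rightarrow> nat \<Rightarrow> nat list \<Rightarrow> bool" where
  "finished w h k ms \<longleftrightarrow>
     (\<exists>p. connects k (board_of ms) p) \<or> board_full w h (board_of ms)"

inductive legal_play :: "nat \<Rightarrow> nat \<Rightarrow> nat \<Rightarrow> nat list \<Rightarrow> bool" for w h k where
  start: "legal_play w h k []"
| move: "legal_play w h k ms \<Longrightarrow> \<not> finished w h k ms \<Longrightarrow> c \<in> legal_moves w h (board_of ms)
    \<Longrightarrow> legal_play w h k (ms @ [c])"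

definition connects_first :: "nat \<Rightarrow> player \<Rightarrow> nat list \<Rightarrow> bool" where
  "connects_first k p ms \<longleftrightarrow> (\<exists>n\<le>length ms. connects k (board_of (take n ms)) p \<and>
     (\<forall>m\<le>n. \<not> connects k (board_of (take m ms)) (opponent p)))"

definition wins :: "nat \<Rightarrow> player \<Rightarrow> nat list \<Rightarrow> bool" where
  "wins k p ms \<longleftrightarrow> connects_first k (opponent p) ms"

text \<open>A strategy maps the play so far to the column to be chosen next.\<close>

type_synonym strategy = "nat list \<Rightarrow> nat"

definition consistent_play ::
    "nat \<Rightarrow> nat \<Rightarrow> nat \<Rightarrow> player \<Rightarrow> strategy \<Rightarrow> nat list \<Rightarrow> bool" where
  "consistent_play w h k p \<sigma> ms \<longleftrightarrow> legal_play w h k ms \<and>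
     (\<forall>i<length ms. to_move (take i ms) = p \<longrightarrow> ms ! i = \<sigma> (take i ms))"

definition winning_strategy :: "nat \<Rightarrow> nat \<Rightarrow> nat \<Rightarrow> player \<Rightarrow> strategy \<Rightarrow> bool" where
  "winning_strategy w h k p \<sigma> \<longleftrightarrow>
     (\<forall>ms. consistent_play w h k p \<sigma> ms \<longrightarrow> \<not> finished w h k ms \<longrightarrow> to_move ms = p \<longrightarrow>
        \<sigma> ms \<in> legal_moves w h (board_of ms)) \<and>
     (\<nexists>s. \<forall>n. consistent_play w h k p \<sigma> (map s [0..<n])) \<and>
     (\<forall>ms. consistent_play w h k p \<sigma> ms \<longrightarrow> finished w h k ms \<longrightarrow> wins k p ms)"

definition take_even_move :: "nat \<Rightarrow> nat \<Rightarrow> board \<Rightarrow> nat \<Rightarrow> bool" where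
  "take_even_move w h b c \<longleftrightarrow> c \<in> legal_moves w h b \<and> even (landing_row b c)"

definition take_even_play :: "nat \<Rightarrow> nat \<Rightarrow> nat \<Rightarrow> nat list \<Rightarrow> bool" where
  "take_even_play w h k ms \<longleftrightarrow> legal_play w h k ms \<and>
     (\<forall>i<length ms. to_move (take i ms) = P2 \<longrightarrow>
        take_even_move w h (board_of (take i ms)) (ms ! i))"

definition take_even_strategy :: "nat \<Rightarrow> nat \<Rightarrow> nat \<Rightarrow> strategy \<Rightarrow> bool" where
  "take_even_strategy w h k \<sigma> \<longleftrightarrow>
     (\<forall>ms. consistent_play w h k P2 \<sigma> ms \<longrightarrow> \<not> finished w h k ms \<longrightarrow> to_move ms = P2 \<longrightarrow>
        take_even_move w h (board_of ms) (\<sigma> ms))"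

end

theory Submission
  imports Defs
begin

text \<open>
  Taking even rows means answering each piece of P1 on top of it. This keeps every column, up to
  its current height, striped: X in the odd rows, O in the even rows, with at most one column
  (the one P1 has just played) of odd height. The stripes are
  \<open>board_of_take_even_play\<close>, the parity of the heights is \<open>odd_height_iff\<close>. Since the board has even
  height, the column of odd height is never full, so the reply exists, and it is the only even one.

  On a striped board two cells in consecutive rows never carry the same piece, so a line of length
  at least 2 can only be horizontal. Beneath a horizontal line of O's lies one of X's, and it was
  already there before the last move, when the game should have ended; hence P2 never connects
  (\<open>P2_never_connects\<close>). A full board has a bottom row of X's only, hence there is no draw. As a play
  has at most as many moves as the board has cells, P1 eventually connects.

  The lemmas treat \<open>w\<close> columns, \<open>h\<close> rows and lines of length \<open>k\<close>. An even \<open>h\<close> provides the reply,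
  \<open>2 \<le> k\<close> makes the lines horizontal, and \<open>0 < h\<close> with \<open>k \<le> w\<close> puts a line of X's in the full
  bottom row.
\<close>

section \<open>Plays and column heights\<close>

lemma position_snoc:
  "position (ms @ [c]) =
     (drop_piece (board_of ms) (to_move ms) c, opponent (to_move ms))"
  by (simp add: position_def board_of_def to_move_def case_prod_unfold)

lemma board_of_snoc: "board_of (ms @ [c]) = drop_piece (board_of ms) (to_move ms) c"
  by (simp add: position_snoc board_of_def[of "ms @ [c]"])

lemma to_move_snoc: "to_move (ms @ [c]) = opponent (to_move ms)"
  by (simp add: position_snoc to_move_def[of "ms @ [c]"])

lemma board_of_Nil: "board_of [] = (\<lambda>_. None)"
  by (simp add: board_of_def position_def)

lemma to_move_Nil: "to_move [] = P1"
  by (simp add: to_move_def position_def)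

lemma to_move_parity: "to_move ms = (if even (length ms) then P1 else P2)"
  by (induction ms rule: rev_induct) (auto simp: to_move_snoc to_move_Nil)

lemma landing_row_eqI:
  assumes "\<And>r. b (c, r) \<noteq> None \<longleftrightarrow> 1 \<le> r \<and> r \<le> n"
  shows "landing_row b c = Suc n"
  unfolding landing_row_def
proof (rule Least_equality)
  show "1 \<le> Suc n \<and> b (c, Suc n) = None"
    using assms[of "Suc n"] by auto
  show "Suc n \<le> r" if "1 \<le> r \<and> b (c, r) = None" for r
    using assms[of r] that by auto
qed

text \<open>Pieces fall down, so a column is filled without gaps, up to the number of times it was
  chosen; \<open>count_list ms c\<close> therefore serves as the height of column \<open>c\<close> from here on.\<close>

lemma occupied_iff: "board_of ms (c, r) \<noteq> None \<longleftrightarrow> 1 \<le> r \<and> r \<le> count_list ms c"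
proof (induction ms arbitrary: c r rule: rev_induct)
  case Nil
  show ?case by (simp add: board_of_Nil)
next
  case (snoc d ms)
  have "landing_row (board_of ms) d = Suc (count_list ms d)"
    by (rule landing_row_eqI) (rule snoc.IH)
  then show ?case
    using snoc.IH[of c r] by (auto simp: board_of_snoc drop_piece_def le_Suc_eq)
qed

lemma landing_row_board_of: "landing_row (board_of ms) c = Suc (count_list ms c)"
  by (rule landing_row_eqI) (rule occupied_iff)

lemma column_full_iff: "column_full h (board_of ms) c \<longleftrightarrow> h \<le> count_list ms c"
  unfolding column_full_def occupied_iff by (cases h) auto

lemma legal_moves_iff:
  "c \<in> legal_moves w h (board_of ms) \<longleftrightarrow> c \<in> {1..w} \<and> count_list ms c < h"
  by (auto simp: legal_moves_def column_full_iff)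

lemma legal_play_snoc:
  "legal_play w h k (ms @ [c]) \<longleftrightarrow>
     legal_play w h k ms \<and> \<not> finished w h k ms \<and> c \<in> legal_moves w h (board_of ms)"
  by (subst legal_play.simps) auto

lemma legal_play_bounds:
  "legal_play w h k ms \<Longrightarrow> set ms \<subseteq> {1..w} \<and> (\<forall>c. count_list ms c \<le> h)"
  by (induction rule: legal_play.induct) (auto simp: legal_moves_iff)

lemma legal_play_length_le:
  assumes "legal_play w h k ms"
  shows "length ms \<le> w * h"
proof -
  have "length ms = (\<Sum>c\<in>{1..w}. count_list ms c)"
    using legal_play_bounds[OF assms] by (simp add: sum_count_set)
  also have "\<dots> \<le> (\<Sum>c\<in>{1..w}. h)"
    using legal_play_bounds[OF assms] by (intro sum_mono) auto
  finally show ?thesis by simp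
qed

lemma no_infinite_legal_play: "\<nexists>s. \<forall>n. legal_play w h k (map s [0..<n])"
proof
  assume "\<exists>s. \<forall>n. legal_play w h k (map s [0..<n])"
  then obtain s where "legal_play w h k (map s [0..<Suc (w * h)])" by blast
  from legal_play_length_le[OF this] show False by simp
qed

section \<open>The striped board\<close>

lemma take_even_play_snoc:
  "take_even_play w h k (ms @ [c]) \<longleftrightarrow>
     take_even_play w h k ms \<and> \<not> finished w h k ms \<and> c \<in> legal_moves w h (board_of ms) \<and>
     (to_move ms = P2 \<longrightarrow> even (landing_row (board_of ms) c))"
  by (auto simp: take_even_play_def take_even_move_def legal_play_snoc nth_append less_Suc_eq)

lemma consistent_play_snoc:
  "consistent_play w h k p \<sigma> (ms @ [c]) \<longleftrightarrow>
     consistent_play w h k p \<sigma> ms \<and> \<not> finished w h k ms \<and> c \<in> legal_moves w h (board_of ms) \<and>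
     (to_move ms = p \<longrightarrow> c = \<sigma> ms)"
  by (auto simp: consistent_play_def legal_play_snoc nth_append less_Suc_eq)

lemma take_even_play_take: "take_even_play w h k ms \<Longrightarrow> take_even_play w h k (take n ms)"
  by (induction ms rule: rev_induct) (auto simp: take_even_play_snoc take_Cons')

text \<open>P1 always finds all heights even and makes one of them odd; the only column whose landing row
  is then even is that one, and filling it restores the even heights.\<close>

lemma odd_height_iff:
  assumes "take_even_play w h k ms"
  shows "odd (count_list ms c) \<longleftrightarrow> odd (length ms) \<and> c = last ms"
  using assms
proof (induction ms arbitrary: c rule: rev_induct)
  case Nil
  show ?case by simp
next
  case (snoc d ms)
  then have IH: "odd (count_list ms c) \<longleftrightarrow> odd (length ms) \<and> c = last ms" for c
    by (simp add: take_even_play_snoc)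
  have reply: "odd (length ms) \<longrightarrow> odd (count_list ms d)"
    using snoc.prems by (simp add: take_even_play_snoc landing_row_board_of to_move_parity)
  show ?case
    using IH[of c] IH[of d] reply by (cases "c = d") auto
qed

definition striped :: "(nat \<Rightarrow> nat) \<Rightarrow> board" where
  "striped ht = (\<lambda>(c, r).
     if 1 \<le> r \<and> r \<le> ht c then Some (if odd r then P1 else P2) else None)"

lemma board_of_take_even_play:
  assumes "take_even_play w h k ms"
  shows "board_of ms = striped (count_list ms)"
  using assms
proof (induction ms rule: rev_induct)
  case Nil
  show ?case by (auto simp: board_of_Nil striped_def)
next
  case (snoc c ms)
  then have play: "take_even_play w h k ms"
    and reply: "to_move ms = P2 \<longrightarrow> odd (count_list ms c)"
    by (auto simp: take_even_play_snoc landing_row_board_of)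
  have "to_move ms = (if odd (Suc (count_list ms c)) then P1 else P2)"
    using reply odd_height_iff[OF play, of c] by (auto simp: to_move_parity split: if_splits)
  then show ?case
    using snoc.IH[OF play]
    by (auto simp: board_of_snoc drop_piece_def landing_row_board_of striped_def fun_eq_iff le_Suc_eq)
qed

text \<open>Every non-horizontal line contains two cells in consecutive rows.\<close>

lemma striped_no_consecutive_rows:
  "\<not> (striped ht (c, r) = Some p \<and> striped ht (c', Suc r) = Some p)"
  by (auto simp: striped_def split: if_splits)

lemma connects_striped_horizontal:
  assumes "connects k (striped ht) p" and "2 \<le> k"
  obtains c r where "\<And>i. i < k \<Longrightarrow> striped ht (c + i, r) = Some p"
proof -
  obtain c r where
    "(\<forall>i<k. striped ht (c + i, r) = Some p) \<or>
     (\<forall>i<k. striped ht (c, r + i) = Some p) \<or>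
     (\<forall>i<k. striped ht (c + i, r + i) = Some p) \<or>
     (\<forall>i<k. striped ht (c + i, r + (k - 1 - i)) = Some p)"
    using assms(1) unfolding connects_def by blast
  then consider (horizontal) "\<forall>i<k. striped ht (c + i, r) = Some p"
    | (vertical) "\<forall>i<k. striped ht (c, r + i) = Some p"
    | (rising) "\<forall>i<k. striped ht (c + i, r + i) = Some p"
    | (falling) "\<forall>i<k. striped ht (c + i, r + (k - 1 - i)) = Some p"
    by blast
  then show thesis
  proof cases
    case horizontal
    then show thesis using that by blast
  next
    case vertical
    have "striped ht (c, r) = Some p" "striped ht (c, Suc r) = Some p"
      using vertical[rule_format, of 0] vertical[rule_format, of 1] assms(2) by simp_all
    then show thesis using striped_no_consecutive_rows by blast
  next
    case rising
    have "striped ht (c, r) = Some p" "striped ht (c + 1, Suc r) = Some p"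
      using rising[rule_format, of 0] rising[rule_format, of 1] assms(2) by simp_all
    then show thesis using striped_no_consecutive_rows by blast
  next
    case falling
    \<comment> \<open>the two lowest cells of the line\<close>
    from falling[rule_format, of "k - 1"] falling[rule_format, of "k - 2"] assms(2)
    have "striped ht (c + (k - 1), r) = Some p" "striped ht (c + (k - 2), Suc r) = Some p"
      by (auto simp: Suc_diff_Suc numeral_2_eq_2)
    then show thesis using striped_no_consecutive_rows by blast
  qed
qed

lemma connects_horizontalI:
  "(\<And>i. i < k \<Longrightarrow> b (c + i, r) = Some p) \<Longrightarrow> connects k b p"
  unfolding connects_def by blast

section \<open>Outcome of the game\<close>

text \<open>A row of O's in row \<open>r\<close> after the last move needs columns of height at least \<open>r\<close>. Before that
  move they had height at least \<open>r - 1\<close>, so row \<open>r - 1\<close> already held a line of X's, and the last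
  move could not have been played.\<close>

lemma P2_never_connects:
  assumes "2 \<le> k" and "take_even_play w h k ms"
  shows "\<not> connects k (board_of ms) P2"
proof
  assume line: "connects k (board_of ms) P2"
  obtain c r where O_line: "\<And>i. i < k \<Longrightarrow> striped (count_list ms) (c + i, r) = Some P2"
    using line assms board_of_take_even_play connects_striped_horizontal by metis
  have cell: "even r \<and> 1 \<le> r \<and> r \<le> count_list ms (c + i)" if "i < k" for i
    using O_line[OF that] by (auto simp: striped_def split: if_splits)
  from cell[of 0] have row: "even r" "1 \<le> r"
    using assms(1) by auto
  obtain ms' m where ms: "ms = ms' @ [m]"
    using cell[of 0] assms(1) by (cases ms rule: rev_cases) auto
  then have play: "take_even_play w h k ms'" and "\<not> finished w h k ms'"
    using assms(2) by (auto simp: take_even_play_snoc)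
  have "board_of ms' (c + i, r - 1) = Some P1" if "i < k" for i
  proof -
    have "odd (r - 1)" "1 \<le> r - 1"
      using row by presburger+
    moreover have "r - 1 \<le> count_list ms' (c + i)"
      using cell[OF that] by (cases "m = c + i") (simp_all add: ms le_diff_conv)
    ultimately show ?thesis
      by (simp add: board_of_take_even_play[OF play] striped_def)
  qed
  then have "connects k (board_of ms') P1"
    by (rule connects_horizontalI)
  with \<open>\<not> finished w h k ms'\<close> show False
    by (auto simp: finished_def)
qed

text \<open>On a full board the bottom row consists of X's only, which rules out a draw.\<close>

lemma finished_P1_connects_first:
  assumes "0 < h" and "2 \<le> k" and "k \<le> w"
    and play: "take_even_play w h k ms" and "finished w h k ms"
  shows "connects_first k P1 ms"
proof -
  have "connects k (board_of ms) P1"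
  proof (cases "board_full w h (board_of ms)")
    case True
    have "1 \<le> count_list ms (1 + i)" if "i < k" for i
    proof -
      have "1 + i \<in> {1..w}"
        using assms(3) that by simp
      then have "h \<le> count_list ms (1 + i)"
        using True unfolding board_full_def column_full_iff by blast
      then show ?thesis
        using assms(1) by linarith
    qed
    then show ?thesis
      by (intro connects_horizontalI[where c = 1 and r = 1])
         (auto simp: board_of_take_even_play[OF play] striped_def)
  next
    case False
    then show ?thesis
      using assms(5) P2_never_connects[OF assms(2) play]
      unfolding finished_def by (metis player.exhaust)
  qed
  then show ?thesis
    using P2_never_connects[OF assms(2) take_even_play_take[OF play]]
    by (auto simp: connects_first_def intro!: exI[of _ "length ms"])
qed

text \<open>The column just played by P1 has odd height, so it is not full on a board of even height.\<close>

lemma take_even_move_iff_last: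
  assumes "even h" and play: "take_even_play w h k ms" and "to_move ms = P2"
  shows "take_even_move w h (board_of ms) c \<longleftrightarrow> c = last ms"
proof -
  have odd: "odd (count_list ms c) \<longleftrightarrow> c = last ms" for c
    using odd_height_iff[OF play, of c] assms(3) by (auto simp: to_move_parity split: if_splits)
  have "ms \<noteq> []"
    using assms(3) by (auto simp: to_move_Nil)
  then have "last ms \<in> {1..w}" "count_list ms (last ms) \<le> h"
    using legal_play_bounds play last_in_set unfolding take_even_play_def by blast+
  moreover have "count_list ms (last ms) \<noteq> h"
    using odd assms(1) by metis
  ultimately show ?thesis
    using odd[of c] by (auto simp: take_even_move_def legal_moves_iff landing_row_board_of)
qed

text \<open>The strategy has to take an even row only where it has done so before. For the strategy of
  repeating P1's column this is essential: only the stripes built so far show that the row above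
  P1's last piece is even.\<close>

lemma consistent_play_imp_take_even_play:
  assumes "\<And>ms. consistent_play w h k P2 \<sigma> ms \<Longrightarrow> take_even_play w h k ms \<Longrightarrow>
             \<not> finished w h k ms \<Longrightarrow> to_move ms = P2 \<Longrightarrow> take_even_move w h (board_of ms) (\<sigma> ms)"
    and "consistent_play w h k P2 \<sigma> ms"
  shows "take_even_play w h k ms"
  using assms(2)
proof (induction ms rule: rev_induct)
  case Nil
  show ?case by (simp add: take_even_play_def legal_play.start)
next
  case (snoc c ms)
  then have consistent: "consistent_play w h k P2 \<sigma> ms" and "\<not> finished w h k ms"
    and "c \<in> legal_moves w h (board_of ms)" and "to_move ms = P2 \<longrightarrow> c = \<sigma> ms"
    by (simp_all add: consistent_play_snoc)
  moreover have play: "take_even_play w h k ms"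
    using snoc.IH consistent .
  ultimately show ?case
    using assms(1)[OF consistent play] by (auto simp: take_even_play_snoc take_even_move_def)
qed

lemma take_even_strategy_winning:
  assumes "0 < h" and "2 \<le> k" and "k \<le> w" and strategy: "take_even_strategy w h k \<sigma>"
  shows "winning_strategy w h k P2 \<sigma>"
proof -
  have play: "take_even_play w h k ms" if "consistent_play w h k P2 \<sigma> ms" for ms
    using that
    by (rule consistent_play_imp_take_even_play[rotated])
       (use strategy in \<open>simp add: take_even_strategy_def\<close>)
  have "\<nexists>s. \<forall>n. consistent_play w h k P2 \<sigma> (map s [0..<n])"
    using no_infinite_legal_play unfolding consistent_play_def by blast
  moreover have "wins k P2 ms" if "consistent_play w h k P2 \<sigma> ms" "finished w h k ms" for ms
    using finished_P1_connects_first[OF assms(1-3) play] that by (simp add: wins_def)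
  ultimately show ?thesis
    using strategy unfolding winning_strategy_def take_even_strategy_def take_even_move_def by blast
qed

lemma take_even_strategy_last:
  assumes "even h"
  shows "take_even_strategy w h k last"
proof -
  have "take_even_play w h k ms" if "consistent_play w h k P2 last ms" for ms
    using that
    by (rule consistent_play_imp_take_even_play[rotated]) (simp add: take_even_move_iff_last[OF assms])
  then show ?thesis
    using take_even_move_iff_last[OF assms] unfolding take_even_strategy_def by blast
qed

theorem theorem1:
  shows "(\<forall>ms. take_even_play 7 6 4 ms \<and> \<not> finished 7 6 4 ms \<and> to_move ms = P2 \<longrightarrow>
            (\<exists>c. take_even_move 7 6 (board_of ms) c) \<and>
            (\<forall>c. take_even_move 7 6 (board_of ms) c \<longleftrightarrow> c = last ms)) \<and>
         (\<nexists>s. \<forall>n. take_even_play 7 6 4 (map s [0..<n])) \<and>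
         (\<forall>ms. take_even_play 7 6 4 ms \<and> finished 7 6 4 ms \<longrightarrow> connects_first 4 P1 ms) \<and>
         (\<forall>ms. take_even_play 7 6 4 ms \<longrightarrow> \<not> connects 4 (board_of ms) P2) \<and>
         (\<forall>\<sigma>. take_even_strategy 7 6 4 \<sigma> \<longrightarrow> winning_strategy 7 6 4 P2 \<sigma>) \<and>
         (\<exists>\<sigma>. take_even_strategy 7 6 4 \<sigma> \<and> winning_strategy 7 6 4 P2 \<sigma>)"
proof (intro conjI)
  have reply: "take_even_move 7 6 (board_of ms) c \<longleftrightarrow> c = last ms"
    if "take_even_play 7 6 4 ms" "to_move ms = P2" for ms c
    by (rule take_even_move_iff_last[OF _ that]) simp
  then show "\<forall>ms. take_even_play 7 6 4 ms \<and> \<not> finished 7 6 4 ms \<and> to_move ms = P2 \<longrightarrow>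
      (\<exists>c. take_even_move 7 6 (board_of ms) c) \<and>
      (\<forall>c. take_even_move 7 6 (board_of ms) c \<longleftrightarrow> c = last ms)"
    by blast
  show "\<nexists>s. \<forall>n. take_even_play 7 6 4 (map s [0..<n])"
    using no_infinite_legal_play unfolding take_even_play_def by blast
  show "\<forall>ms. take_even_play 7 6 4 ms \<and> finished 7 6 4 ms \<longrightarrow> connects_first 4 P1 ms"
    using finished_P1_connects_first[of 6 4 7] by simp
  show "\<forall>ms. take_even_play 7 6 4 ms \<longrightarrow> \<not> connects 4 (board_of ms) P2"
    using P2_never_connects[of 4 7 6] by simp
  show winning: "\<forall>\<sigma>. take_even_strategy 7 6 4 \<sigma> \<longrightarrow> winning_strategy 7 6 4 P2 \<sigma>"
    using take_even_strategy_winning[of 6 4 7] by simp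
  have "take_even_strategy 7 6 4 last"
    by (rule take_even_strategy_last) simp
  with winning show "\<exists>\<sigma>. take_even_strategy 7 6 4 \<sigma> \<and> winning_strategy 7 6 4 P2 \<sigma>"
    by blast
qed

end
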